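(* Let $f_1=\cosh\chi\cos\phi$, $f_2=\cosh\chi\sin\phi$, $f_3=\sinh\chi$ on the one-sheeted hyperboloid $D^2$, and let $\mathcal{H}_1^+=\{Xf_1+Yf_2+Zf_3:(X,Y,Z)\in\mathbb{R}^3\}$ with Poisson bracket $$\{F,F'\}=\frac{1}{\cosh\chi}\left(\frac{\partial F}{\partial\chi}\frac{\partial F'}{\partial\phi}-\frac{\partial F}{\partial\phi}\frac{\partial F'}{\partial\chi}\right).$$ Identify $F=Xf_1+Yf_2+Zf_3$ with $(X,Y,Z)$. Then the Poisson algebra $\mathcal{H}_1^+$ is isomorphic to the Lie algebra $\mathbb{R}^3_H$, and the isomorphism is given by the inversion of sign $F\mapsto -F$.
   Context: $\mathbb{R}^3_H$ is the Lie algebra $\mathbb{R}^3$ with the vector product $(x,y,z)\,\bar\wedge\,(x',y',z')=(yz'-zy',\,zx'-xz',\,-(xy'-yx'))$. The hyperboloid $D^2$ is $\{x^2+y^2-z^2=1\}$ with coordinates $x=\cosh\chi\cos\phi$, $y=\cosh\chi\sin\phi$, $z=\sinh\chi$. *)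

theory Defs
  imports "HOL-Analysis.Analysis" "HOL-Library.Function_Algebras"
begin

text \<open>Function spaces as real vector spaces, extending the pointwise additive structure of
  \<^theory>\<open>HOL-Library.Function_Algebras\<close>.\<close>

instantiation "fun" :: (type, real_vector) real_vector
begin

definition scaleR_fun :: "real \<Rightarrow> ('a \<Rightarrow> 'b) \<Rightarrow> 'a \<Rightarrow> 'b"
  where "scaleR_fun c F = (\<lambda>x. c *\<^sub>R F x)"

instance
  by standard (auto simp: scaleR_fun_def fun_eq_iff scaleR_add_right scaleR_add_left)

end

text \<open>A real Lie algebra is given by a subspace \<open>L\<close> of an ambient real vector space and a bracket;
  only the values of the bracket on \<open>L\<close> matter.\<close>

definition lie_algebra :: "'a::real_vector set \<Rightarrow> ('a \<Rightarrow> 'a \<Rightarrow> 'a) \<Rightarrow> bool" where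
  "lie_algebra L br \<longleftrightarrow>
     subspace L \<and>
     (\<forall>x\<in>L. \<forall>y\<in>L. br x y \<in> L) \<and>
     (\<forall>x\<in>L. \<forall>y\<in>L. \<forall>z\<in>L. \<forall>a b. br (a *\<^sub>R x + b *\<^sub>R y) z = a *\<^sub>R br x z + b *\<^sub>R br y z) \<and>
     (\<forall>x\<in>L. \<forall>y\<in>L. \<forall>z\<in>L. \<forall>a b. br z (a *\<^sub>R x + b *\<^sub>R y) = a *\<^sub>R br z x + b *\<^sub>R br z y) \<and>
     (\<forall>x\<in>L. br x x = 0) \<and>
     (\<forall>x\<in>L. \<forall>y\<in>L. \<forall>z\<in>L. br x (br y z) + br y (br z x) + br z (br x y) = 0)"

definition lie_algebra_iso ::
  "'a::real_vector set \<Rightarrow> ('a \<Rightarrow> 'a \<Rightarrow> 'a) \<Rightarrow> 'b::real_vector set \<Rightarrow> ('b \<Rightarrow> 'b \<Rightarrow> 'b) \<Rightarrow> ('a \<Rightarrow> 'b) \<Rightarrow> bool" where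
  "lie_algebra_iso L brL M brM h \<longleftrightarrow>
     lie_algebra L brL \<and> lie_algebra M brM \<and>
     bij_betw h L M \<and>
     (\<forall>x\<in>L. \<forall>y\<in>L. \<forall>a b. h (a *\<^sub>R x + b *\<^sub>R y) = a *\<^sub>R h x + b *\<^sub>R h y) \<and>
     (\<forall>x\<in>L. \<forall>y\<in>L. h (brL x y) = brM (h x) (h y))"

text \<open>The bracket of \<open>\<real>\<^sup>3\<^sub>H\<close>. It differs from \<^const>\<open>cross3\<close> by the sign of the third component.\<close>

definition cross_H :: "real^3 \<Rightarrow> real^3 \<Rightarrow> real^3" where
  "cross_H v w = vector
     [v$2 * w$3 - v$3 * w$2,
      v$3 * w$1 - v$1 * w$3,
      - (v$1 * w$2 - v$2 * w$1)]"

text \<open>The coordinate usually called chi is written \<open>u\<close>: the symbol is taken by the binder of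
  \<^const>\<open>vec_lambda\<close>.\<close>

typedef hyperboloid = "{p :: real^3. (p$1)\<^sup>2 + (p$2)\<^sup>2 - (p$3)\<^sup>2 = 1}"
  by (rule exI[of _ "vector [1, 0, 0]"]) simp

definition hyp_point :: "real \<Rightarrow> real \<Rightarrow> hyperboloid" where
  "hyp_point u \<phi> = Abs_hyperboloid (vector [cosh u * cos \<phi>, cosh u * sin \<phi>, sinh u])"

text \<open>The coordinates of a point. The angle is only determined modulo \<open>2\<pi>\<close>; we take the
  representative in \<open>(-\<pi>, \<pi>]\<close>. The lemma \<open>poisson_bracket_hyp_point\<close> below shows that
  the Poisson bracket does not depend on this choice.\<close>

definition hyp_chi :: "hyperboloid \<Rightarrow> real" where
  "hyp_chi p = arsinh (Rep_hyperboloid p $ 3)"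

definition hyp_phi :: "hyperboloid \<Rightarrow> real" where
  "hyp_phi p = Arg (Complex (Rep_hyperboloid p $ 1) (Rep_hyperboloid p $ 2))"

definition f1 :: "hyperboloid \<Rightarrow> real" where "f1 p = cosh (hyp_chi p) * cos (hyp_phi p)"
definition f2 :: "hyperboloid \<Rightarrow> real" where "f2 p = cosh (hyp_chi p) * sin (hyp_phi p)"
definition f3 :: "hyperboloid \<Rightarrow> real" where "f3 p = sinh (hyp_chi p)"

definition deriv_chi :: "(hyperboloid \<Rightarrow> real) \<Rightarrow> hyperboloid \<Rightarrow> real" where
  "deriv_chi F p = deriv (\<lambda>t. F (hyp_point t (hyp_phi p))) (hyp_chi p)"

definition deriv_phi :: "(hyperboloid \<Rightarrow> real) \<Rightarrow> hyperboloid \<Rightarrow> real" where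
  "deriv_phi F p = deriv (\<lambda>t. F (hyp_point (hyp_chi p) t)) (hyp_phi p)"

definition poisson_bracket ::
  "(hyperboloid \<Rightarrow> real) \<Rightarrow> (hyperboloid \<Rightarrow> real) \<Rightarrow> hyperboloid \<Rightarrow> real" where
  "poisson_bracket F G = (\<lambda>p. 1 / cosh (hyp_chi p) *
     (deriv_chi F p * deriv_phi G p - deriv_phi F p * deriv_chi G p))"

definition lin_fun :: "real^3 \<Rightarrow> hyperboloid \<Rightarrow> real" where
  "lin_fun v = v$1 *\<^sub>R f1 + v$2 *\<^sub>R f2 + v$3 *\<^sub>R f3"

definition H1_plus :: "(hyperboloid \<Rightarrow> real) set" where
  "H1_plus = {X *\<^sub>R f1 + Y *\<^sub>R f2 + Z *\<^sub>R f3 | X Y Z. True}"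

lemma Rep_hyp_point:
  "Rep_hyperboloid (hyp_point u \<phi>) = vector [cosh u * cos \<phi>, cosh u * sin \<phi>, sinh u]"
proof -
  have "(cosh u * cos \<phi>)\<^sup>2 + (cosh u * sin \<phi>)\<^sup>2 = (cosh u)\<^sup>2 * ((cos \<phi>)\<^sup>2 + (sin \<phi>)\<^sup>2)"
    by (simp only: power_mult_distrib distrib_left)
  then show ?thesis
    unfolding hyp_point_def by (subst Abs_hyperboloid_inverse) (simp_all add: cosh_square_eq)
qed

lemma hyp_chi_hyp_point: "hyp_chi (hyp_point u \<phi>) = u"
  by (simp add: hyp_chi_def Rep_hyp_point arsinh_sinh_real)

lemma hyp_phi_hyp_point: "\<exists>k::int. hyp_phi (hyp_point u \<phi>) = \<phi> + 2 * pi * k"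
proof -
  have eq: "Complex (cosh u * cos \<phi>) (cosh u * sin \<phi>) = rcis (cosh u) \<phi>"
    by (simp add: complex_eq_iff)
  have "is_Arg (rcis (cosh u) \<phi>) (Arg (rcis (cosh u) \<phi>))"
    by (rule is_Arg_Arg) simp
  then have "cis (Arg (rcis (cosh u) \<phi>)) = cis \<phi>"
    by (simp add: is_Arg_def rcis_def cis_conv_exp norm_mult)
  then have "sin (Arg (rcis (cosh u) \<phi>)) = sin \<phi> \<and> cos (Arg (rcis (cosh u) \<phi>)) = cos \<phi>"
    by (simp add: complex_eq_iff)
  then obtain k :: int where "Arg (rcis (cosh u) \<phi>) = \<phi> + 2 * pi * k"
    by (auto simp: sin_cos_eq_iff)
  then show ?thesis
    by (auto simp: hyp_phi_def Rep_hyp_point eq)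
qed

lemma hyp_point_periodic: "hyp_point u (\<phi> + 2 * pi * of_int k) = hyp_point u \<phi>"
proof -
  have "sin (\<phi> + 2 * pi * of_int k) = sin \<phi> \<and> cos (\<phi> + 2 * pi * of_int k) = cos \<phi>"
    by (subst sin_cos_eq_iff) auto
  then show ?thesis by (simp add: hyp_point_def)
qed

lemma hyp_point_surj: "hyp_point (hyp_chi p) (hyp_phi p) = p"
proof -
  define v where "v = Rep_hyperboloid p"
  have eq: "(v$1)\<^sup>2 + (v$2)\<^sup>2 - (v$3)\<^sup>2 = 1" using Rep_hyperboloid[of p] by (simp add: v_def)
  define z where "z = Complex (v$1) (v$2)"
  have ch: "cosh (hyp_chi p) = cmod z"
    using eq by (simp add: hyp_chi_def z_def cmod_def v_def[symmetric] cosh_arsinh_real algebra_simps)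
  have "z \<noteq> 0"
  proof
    assume "z = 0"
    then have "(v$3)\<^sup>2 = - 1" using eq by (simp add: z_def complex_eq_iff)
    then show False using zero_le_power2[of "v$3"] by linarith
  qed
  then have "is_Arg z (Arg z)" by (rule is_Arg_Arg)
  then have "z = rcis (cmod z) (Arg z)" by (simp add: is_Arg_def rcis_def cis_conv_exp)
  then have "v$1 = cmod z * cos (Arg z)" "v$2 = cmod z * sin (Arg z)"
    by (metis Re_rcis z_def complex.sel(1), metis Im_rcis z_def complex.sel(2))
  moreover have "hyp_phi p = Arg z" by (simp add: hyp_phi_def z_def v_def)
  moreover have "sinh (hyp_chi p) = v$3" by (simp add: hyp_chi_def v_def)
  ultimately have "Rep_hyperboloid (hyp_point (hyp_chi p) (hyp_phi p)) = v"
    by (simp add: Rep_hyp_point ch vec_eq_iff forall_3)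
  then show ?thesis by (simp add: v_def Rep_hyperboloid_inject)
qed

lemma f_hyp_point:
  "f1 (hyp_point u \<phi>) = cosh u * cos \<phi>"
  "f2 (hyp_point u \<phi>) = cosh u * sin \<phi>"
  "f3 (hyp_point u \<phi>) = sinh u"
proof -
  obtain k :: int where k: "hyp_phi (hyp_point u \<phi>) = \<phi> + 2 * pi * k"
    using hyp_phi_hyp_point by blast
  have "sin (\<phi> + 2 * pi * k) = sin \<phi> \<and> cos (\<phi> + 2 * pi * k) = cos \<phi>"
    by (subst sin_cos_eq_iff) auto
  then show "f1 (hyp_point u \<phi>) = cosh u * cos \<phi>" "f2 (hyp_point u \<phi>) = cosh u * sin \<phi>"
      "f3 (hyp_point u \<phi>) = sinh u"
    by (simp_all add: f1_def f2_def f3_def hyp_chi_hyp_point k)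
qed

lemma poisson_bracket_hyp_point:
  "poisson_bracket F G (hyp_point u \<phi>) = 1 / cosh u *
     (deriv (\<lambda>t. F (hyp_point t \<phi>)) u * deriv (\<lambda>t. G (hyp_point u t)) \<phi>
      - deriv (\<lambda>t. F (hyp_point u t)) \<phi> * deriv (\<lambda>t. G (hyp_point t \<phi>)) u)"
proof -
  obtain k :: int where k: "hyp_phi (hyp_point u \<phi>) = \<phi> + 2 * pi * k"
    using hyp_phi_hyp_point by blast
  have "deriv (\<lambda>t. E (hyp_point u t)) (\<phi> + 2 * pi * k) = deriv (\<lambda>t. E (hyp_point u t)) \<phi>"
    for E :: "hyperboloid \<Rightarrow> real"
    unfolding deriv_def by (subst DERIV_shift) (simp add: hyp_point_periodic)
  then show ?thesis
    by (simp add: poisson_bracket_def deriv_chi_def deriv_phi_def hyp_chi_hyp_point k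
        hyp_point_periodic)
qed

end

theory Submission
  imports Defs
begin

text \<open>
  On the three generators, $\cos^2\phi + \sin^2\phi = 1$ gives $\{f_1,f_2\} = f_3$, and
  $\{f_2,f_3\} = -f_1$, $\{f_3,f_1\} = -f_2$. These are the structure constants of
  \<^const>\<open>cross_H\<close> with the opposite sign, so
  \<open>poisson_bracket (lin_fun v) (lin_fun w) = - lin_fun (cross_H v w)\<close>. The bracket
  \<open>cross_H v w\<close> does not change when both \<open>v\<close> and \<open>w\<close> change sign, so composing \<^const>\<open>lin_fun\<close> with the sign
  change \<open>v \<mapsto> - v\<close> absorbs this sign: \<open>v \<mapsto> - lin_fun v\<close> intertwines \<^const>\<open>cross_H\<close> with the
  Poisson bracket.

  That \<^const>\<open>H1_plus\<close> is a Lie algebra at all, the Jacobi identity in particular, is then not a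
  matter of differentiating nested brackets: for \<^const>\<open>cross_H\<close> it is a polynomial identity in the
  components, and it is carried over by the linear bijection \<open>v \<mapsto> - lin_fun v\<close>
  (\<open>lie_algebra_iso_inv\<close>).
\<close>

lemma lie_algebra_cross_H: "lie_algebra (UNIV :: (real^3) set) cross_H"
  by (simp add: lie_algebra_def cross_H_def vec_eq_iff forall_3) (simp add: algebra_simps)

text \<open>Transport of structure. The set \<open>range g\<close> inherits every Lie algebra axiom from \<open>br\<close>, since an
  element of it has the form \<open>g v\<close> and \<open>brL\<close> is, on such elements, the image of \<open>br\<close>.\<close>

lemma lie_algebra_iso_inv:
  fixes g :: "'b::real_vector \<Rightarrow> 'a::real_vector"
  assumes br: "lie_algebra UNIV br" and lin: "linear g" and inj: "inj g"
    and hom: "\<And>v w. brL (g v) (g w) = g (br v w)"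
  shows "lie_algebra_iso (range g) brL UNIV br (inv g)"
proof -
  note push = linear_add[OF lin, symmetric] linear_scale[OF lin, symmetric]
  have "subspace (range g)"
    using linear_subspace_image[OF lin] by simp
  moreover have "br x (br y z) + br y (br z x) + br z (br x y) = 0" for x y z
    using br by (simp add: lie_algebra_def)
  ultimately have "lie_algebra (range g) brL"
    using br linear_0[OF lin] by (auto simp: lie_algebra_def hom push)
  moreover have "bij_betw (inv g) (range g) UNIV"
    using inj by (simp add: bij_betw_inv_into inj_imp_bij_betw_inv)
  ultimately show ?thesis
    using br inj by (auto simp: lie_algebra_iso_def hom push)
qed

lemma lin_fun_hyp_point:
  "lin_fun v (hyp_point u \<phi>) = v$1 * (cosh u * cos \<phi>) + v$2 * (cosh u * sin \<phi>) + v$3 * sinh u"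
  by (simp add: lin_fun_def scaleR_fun_def f_hyp_point)

lemma linear_lin_fun: "linear lin_fun"
  by (rule linearI) (simp_all add: lin_fun_def scaleR_add_left scaleR_add_right)

text \<open>A vector is recovered from its linear function by evaluating at points of the hyperboloid: two
  on the waist circle give the first two components, and any point off the waist gives the third.\<close>

lemma inj_lin_fun: "inj lin_fun"
proof (rule injI)
  fix v w :: "real^3"
  assume eq: "lin_fun v = lin_fun w"
  have at: "lin_fun v (hyp_point u \<phi>) = lin_fun w (hyp_point u \<phi>)" for u \<phi>
    by (simp add: eq)
  have 1: "v$1 = w$1"
    using at[of 0 0] by (simp add: lin_fun_hyp_point)
  have 2: "v$2 = w$2"
    using at[of 0 "pi/2"] by (simp add: lin_fun_hyp_point)
  have 3: "v$3 = w$3"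
    using at[of "arsinh 1" 0] 1 by (simp add: lin_fun_hyp_point)
  show "v = w"
    using 1 2 3 by (simp add: vec_eq_iff forall_3)
qed

lemma range_lin_fun: "range lin_fun = H1_plus"
proof
  show "range lin_fun \<subseteq> H1_plus"
    by (auto simp: H1_plus_def lin_fun_def)
  show "H1_plus \<subseteq> range lin_fun"
  proof
    fix F assume "F \<in> H1_plus"
    then obtain X Y Z where "F = X *\<^sub>R f1 + Y *\<^sub>R f2 + Z *\<^sub>R f3"
      by (auto simp: H1_plus_def)
    then have "F = lin_fun (vector [X, Y, Z])"
      by (simp add: lin_fun_def)
    then show "F \<in> range lin_fun" by blast
  qed
qed

text \<open>The one computation with derivatives. Differentiating in the angle leaves a factor \<open>cosh u\<close>,
  which cancels the \<open>1 / cosh u\<close> of the bracket. Of what remains, the terms with \<open>sinh u\<close> are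
  quadratic in \<open>cos \<phi>\<close> and \<open>sin \<phi>\<close>: their mixed parts cancel and their squares add up
  to 1, so that a linear function is left.\<close>

lemma poisson_bracket_lin_fun:
  "poisson_bracket (lin_fun v) (lin_fun w) = - lin_fun (cross_H v w)"
proof
  fix p
  define u \<phi> where "u = hyp_chi p" and "\<phi> = hyp_phi p"
  have p: "p = hyp_point u \<phi>"
    by (simp add: u_def \<phi>_def hyp_point_surj)
  have d_chi: "deriv (\<lambda>t. lin_fun a (hyp_point t \<phi>)) u
      = (a$1 * cos \<phi> + a$2 * sin \<phi>) * sinh u + a$3 * cosh u" for a
    unfolding lin_fun_hyp_point
    by (rule DERIV_imp_deriv) (auto intro!: derivative_eq_intros simp: algebra_simps)
  have d_phi: "deriv (\<lambda>t. lin_fun a (hyp_point u t)) \<phi>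
      = cosh u * (a$2 * cos \<phi> - a$1 * sin \<phi>)" for a
    unfolding lin_fun_hyp_point
    by (rule DERIV_imp_deriv) (auto intro!: derivative_eq_intros simp: algebra_simps)
  define c s C S where "c = cos \<phi>" and "s = sin \<phi>" and "C = cosh u" and "S = sinh u"
  have C: "C \<noteq> 0" by (simp add: C_def)
  have circle: "c * c + s * s = 1"
    using sin_cos_squared_add3[of \<phi>] by (simp add: c_def s_def)
  have "poisson_bracket (lin_fun v) (lin_fun w) p
      = ((v$1 * c + v$2 * s) * S + v$3 * C) * (w$2 * c - w$1 * s)
      - (v$2 * c - v$1 * s) * ((w$1 * c + w$2 * s) * S + w$3 * C)"
    unfolding p poisson_bracket_hyp_point d_chi d_phi
    unfolding c_def[symmetric] s_def[symmetric] C_def[symmetric] S_def[symmetric]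
    using C by (simp add: field_simps)
  also have "\<dots> = (v$1 * w$2 - v$2 * w$1) * (c * c + s * s) * S
      - (v$2 * w$3 - v$3 * w$2) * (C * c) - (v$3 * w$1 - v$1 * w$3) * (C * s)"
    by (simp add: algebra_simps)
  also have "\<dots> = (- lin_fun (cross_H v w)) p"
    unfolding circle p
    by (simp add: lin_fun_hyp_point cross_H_def c_def s_def C_def S_def algebra_simps)
  finally show "poisson_bracket (lin_fun v) (lin_fun w) p = (- lin_fun (cross_H v w)) p" .
qed

theorem proposition2p3:
  shows "linear lin_fun \<and> bij_betw lin_fun UNIV H1_plus \<and>
    lie_algebra_iso H1_plus poisson_bracket (UNIV :: (real^3) set) cross_H
      (\<lambda>F. inv_into UNIV lin_fun (- F))"
proof (intro conjI)
  show "linear lin_fun" by (rule linear_lin_fun)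
  show bij: "bij_betw lin_fun UNIV H1_plus"
    by (simp add: bij_betw_def inj_lin_fun range_lin_fun)
  define g where "g v = lin_fun (- v)" for v
  have g_minus: "g v = - lin_fun v" for v
    by (simp add: g_def linear_neg[OF linear_lin_fun])
  have lin: "linear g"
    using linear_compose_neg[OF linear_lin_fun] by (simp add: g_minus[abs_def])
  have inj: "inj g"
    using inj_lin_fun by (auto simp: inj_def g_minus)
  have range: "range g = H1_plus"
    unfolding g_def using range_lin_fun by (metis image_image surj_uminus)
  have hom: "poisson_bracket (g v) (g w) = g (cross_H v w)" for v w
  proof -
    have "cross_H (- v) (- w) = cross_H v w"
      by (simp add: cross_H_def)
    then show ?thesis
      unfolding g_minus[of "cross_H v w"] by (simp add: g_def poisson_bracket_lin_fun)
  qed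
  have iso: "lie_algebra_iso H1_plus poisson_bracket UNIV cross_H (inv g)"
    using lie_algebra_iso_inv[OF lie_algebra_cross_H lin inj hom] by (simp add: range)
  have "g v = F \<longleftrightarrow> lin_fun v = - F" for v F
    by (auto simp: g_minus)
  then have "inv g = (\<lambda>F. inv lin_fun (- F))"
    by (simp add: inv_into_def fun_eq_iff[of "inv g"])
  with iso show "lie_algebra_iso H1_plus poisson_bracket UNIV cross_H (\<lambda>F. inv lin_fun (- F))"
    by simp
qed

end
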